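(* Let $f:S\to\mathbb{R}^n$ be a differentiable map with $S\subset\mathbb{R}^m$ open, and let $\kappa(f,x)$ be the condition number with respect to the coordinatewise relative error metric on both the domain and the codomain. Then the following holds. (i) If $x\in S$ and there exists an open neighborhood $N$ of $x$ such that $f(N)$ is contained in one connected component of $\mathbb{R}^n$, then $$\kappa(f,x)=\big\|\operatorname{diag}(f(x))^{\dagger}\,\mathrm{D}_xf\,\operatorname{diag}(x)\big\|_2 ,$$ where $\|\cdot\|_2$ is the spectral norm, $\mathrm{D}_xf$ is the derivative of $f$ at $x$, and $\operatorname{diag}(z)$ is the diagonal matrix whose diagonal entries are the entries of the vector $z$. In particular, if $f$ takes an open neighborhood of $x$ to a constant, then $\kappa(f,x)=0$. (ii) In all other cases (i.e. $x\in S$ but no such $N$ exists), $\kappa(f,x)=\infty$.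
   Context: Metric and topology. $\mathbb{R}^d$ is partitioned into $3^d$ sets $U_0=\{0\},U_1,\dots,U_{3^d-1}$ according to the sign pattern in $\{-1,0,1\}^d$ of a vector; these are the connected components of $\mathbb{R}^d$ in the topology used here. On each $U_j$ one uses the Riemannian metric $\langle v,w\rangle_x=\sum_{i:\,x_i\neq0}v_iw_i/x_i^2$ for $v,w$ in the linear span of $U_j$; the coordinatewise relative error distance is the induced geodesic distance for points of the same $U_j$ and $\infty$ for points of different components. Explicitly, $\operatorname{dist}(x,y)=\big(\sum_{i:\,x_i\ne0}(\log(x_i/y_i))^2\big)^{1/2}$ if $x,y$ have the same sign pattern, and $\infty$ otherwise. Every $\mathbb{R}^d$ is endowed with this metric and the topology it induces (which is finer than the Euclidean one); "open", "open neighborhood" and "connected component" refer to this topology. Near $x\in U_j$ an open set is a subset of $U_j$; only the derivative of $f$ in directions in the linear span of $U_j$ enters the formula, since $\operatorname{diag}(x)z$ always lies in that span. Condition number. For $f:S\to\mathbb{R}^n$ and $x\in S$, $\kappa(f,x)=\lim_{\epsilon\to0}\sup\{\operatorname{dist}(f(x),f(y))/\operatorname{dist}(x,y):y\in S,\ 0<\operatorname{dist}(x,y)\le\epsilon\}\in[0,\infty]$, with $\kappa(f,x)=0$ if $x$ is isolated in $S$. $A^\dagger$ denotes the Moore–Penrose pseudoinverse (for a diagonal matrix: invert the nonzero diagonal entries, keep the zero ones). *)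

theory Defs
  imports "HOL-Analysis.Analysis"
begin

section \<open>Coordinatewise relative error distance\<close>

text \<open>
  The sets \<open>sign_class x\<close> are the \<open>3\<^sup>d\<close> pieces of the partition of Euclidean space by sign pattern.
  A set that is open for \<^emph>\<open>rel_topology\<close> meets each piece in a relatively open subset. A map on such a
  set is differentiable at \<open>x\<close> when it has a derivative at \<open>x\<close> within the piece of \<open>x\<close>; that
  derivative is determined only on the linear span of the piece.
\<close>

definition sign_class :: "real ^ 'n \<Rightarrow> (real ^ 'n) set" where
  "sign_class x = {y. \<forall>i. sgn (y $ i) = sgn (x $ i)}"

definition rel_dist :: "real ^ 'n \<Rightarrow> real ^ 'n \<Rightarrow> ennreal" where
  "rel_dist x y =
    (if y \<in> sign_class x
     then ennreal (sqrt (\<Sum>i | x $ i \<noteq> 0. (ln (x $ i / y $ i))\<^sup>2))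
     else \<infinity>)"

definition rel_topology :: "(real ^ 'n) topology" where
  "rel_topology = topology (\<lambda>U. \<forall>x\<in>U. \<exists>e>0. {y. rel_dist x y < e} \<subseteq> U)"

lemma openin_rel_topology:
  fixes U :: "(real ^ 'n) set"
  shows "openin rel_topology U \<longleftrightarrow> (\<forall>x\<in>U. \<exists>e>0. {y. rel_dist x y < e} \<subseteq> U)"
proof -
  have "istopology (\<lambda>U :: (real ^ 'n) set. \<forall>x\<in>U. \<exists>e>0. {y. rel_dist x y < e} \<subseteq> U)"
    unfolding istopology_def
  proof (intro conjI allI impI ballI)
    fix S T :: "(real ^ 'n) set" and x :: "real ^ 'n"
    assume S: "\<forall>x\<in>S. \<exists>e>0. {y. rel_dist x y < e} \<subseteq> S"
      and T: "\<forall>x\<in>T. \<exists>e>0. {y. rel_dist x y < e} \<subseteq> T" and x: "x \<in> S \<inter> T"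
    obtain d where d: "d > 0" "{y. rel_dist x y < d} \<subseteq> S" using S x by blast
    obtain e where e: "e > 0" "{y. rel_dist x y < e} \<subseteq> T" using T x by blast
    have "min d e > 0" "{y. rel_dist x y < min d e} \<subseteq> S \<inter> T"
      using d e by auto
    then show "\<exists>e>0. {y. rel_dist x y < e} \<subseteq> S \<inter> T" by blast
  next
    fix K :: "(real ^ 'n) set set" and x :: "real ^ 'n"
    assume K: "\<forall>S\<in>K. \<forall>x\<in>S. \<exists>e>0. {y. rel_dist x y < e} \<subseteq> S" and x: "x \<in> \<Union> K"
    obtain T where T: "T \<in> K" "x \<in> T" using x by blast
    then obtain e where "e > 0" "{y. rel_dist x y < e} \<subseteq> T" using K by blast
    then show "\<exists>e>0. {y. rel_dist x y < e} \<subseteq> \<Union> K" using T by blast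
  qed
  then show ?thesis unfolding rel_topology_def by (simp only: topology_inverse')
qed

section \<open>Condition number\<close>

text \<open>
  If \<open>x\<close> is isolated in \<open>S\<close>, the supremum is taken over the empty set for small \<open>\<epsilon>\<close>;
  in \<^typ>\<open>ennreal\<close> this is \<open>0\<close>, so the condition number is \<open>0\<close> as required
  (\<open>cond_number_isolated\<close>).
\<close>

definition cond_sup ::
    "(real ^ 'm) set \<Rightarrow> (real ^ 'm \<Rightarrow> real ^ 'n) \<Rightarrow> real ^ 'm \<Rightarrow> real \<Rightarrow> ennreal" where
  "cond_sup S f x \<epsilon> =
    (SUP y \<in> {y \<in> S. 0 < rel_dist x y \<and> rel_dist x y \<le> ennreal \<epsilon>}.
        rel_dist (f x) (f y) / rel_dist x y)"

definition cond_number ::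
    "(real ^ 'm) set \<Rightarrow> (real ^ 'm \<Rightarrow> real ^ 'n) \<Rightarrow> real ^ 'm \<Rightarrow> ennreal" where
  "cond_number S f x = Lim (at_right 0) (cond_sup S f x)"

text \<open>The limit always exists.\<close>

lemma cond_sup_tendsto: "(cond_sup S f x \<longlongrightarrow> cond_number S f x) (at_right 0)"
proof -
  define L where "L = (INF \<epsilon>\<in>{0<..}. cond_sup S f x \<epsilon>)"
  have mono: "cond_sup S f x d \<le> cond_sup S f x e" if "d \<le> e" for d e
    unfolding cond_sup_def using ennreal_leI[OF that]
    by (intro SUP_subset_mono) auto
  have "(cond_sup S f x \<longlongrightarrow> L) (at_right 0)"
  proof (rule order_tendstoI)
    fix a assume "a < L"
    have "a < cond_sup S f x e" if "e > 0" for e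
    proof -
      have "L \<le> cond_sup S f x e" unfolding L_def by (rule INF_lower) (use that in simp)
      with \<open>a < L\<close> show ?thesis by (rule less_le_trans)
    qed
    then show "\<forall>\<^sub>F e in at_right 0. a < cond_sup S f x e"
      by (simp add: eventually_at_filter)
  next
    fix a assume "L < a"
    then obtain e where e: "e > 0" "cond_sup S f x e < a"
      unfolding L_def by (auto simp: INF_less_iff)
    then show "\<forall>\<^sub>F e in at_right 0. cond_sup S f x e < a"
      unfolding eventually_at_right_field
      using e by (auto intro!: exI[of _ e] intro: le_less_trans[OF mono[OF less_imp_le]])
  qed
  then show ?thesis
    unfolding cond_number_def by (simp add: tendsto_Lim)
qed

lemma cond_number_isolated:
  assumes "\<delta> > 0" and "\<And>y. y \<in> S \<Longrightarrow> 0 < rel_dist x y \<Longrightarrow> ennreal \<delta> < rel_dist x y"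
  shows "cond_number S f x = 0"
proof -
  have "cond_sup S f x e = 0" if "e < \<delta>" for e
  proof -
    have "\<not> rel_dist x y \<le> ennreal e" if "y \<in> S" "0 < rel_dist x y" for y
    proof -
      have "ennreal e \<le> ennreal \<delta>" using \<open>e < \<delta>\<close> by (intro ennreal_leI) simp
      also have "\<dots> < rel_dist x y" using assms(2) that by blast
      finally show ?thesis by simp
    qed
    then have "{y \<in> S. 0 < rel_dist x y \<and> rel_dist x y \<le> ennreal e} = {}"
      by blast
    then show ?thesis by (simp only: cond_sup_def) (simp add: bot_ennreal)
  qed
  then have "\<forall>\<^sub>F e in at_right 0. cond_sup S f x e = 0"
    unfolding eventually_at_right_field using \<open>\<delta> > 0\<close> by blast
  then have "(cond_sup S f x \<longlongrightarrow> 0) (at_right 0)"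
    by (rule tendsto_eventually)
  then show ?thesis
    using cond_sup_tendsto tendsto_unique trivial_limit_at_right_real by blast
qed

section \<open>Matrices\<close>

definition diag_matrix :: "real ^ 'n \<Rightarrow> real ^ 'n ^ 'n" where
  "diag_matrix v = (\<chi> i j. if i = j then v $ i else 0)"

definition is_pseudoinverse :: "real ^ 'n ^ 'm \<Rightarrow> real ^ 'm ^ 'n \<Rightarrow> bool" where
  "is_pseudoinverse A X \<longleftrightarrow>
     A ** X ** A = A \<and> X ** A ** X = X \<and>
     transpose (A ** X) = A ** X \<and> transpose (X ** A) = X ** A"

definition pseudoinverse :: "real ^ 'n ^ 'm \<Rightarrow> real ^ 'm ^ 'n" where
  "pseudoinverse A = (THE X. is_pseudoinverse A X)"

lemma pseudoinverse_unique:
  assumes "is_pseudoinverse A X" "is_pseudoinverse A Y"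
  shows "X = Y"
proof -
  have X: "A ** X ** A = A" "X ** A ** X = X"
      "transpose (A ** X) = A ** X" "transpose (X ** A) = X ** A"
    and Y: "A ** Y ** A = A" "Y ** A ** Y = Y"
      "transpose (A ** Y) = A ** Y" "transpose (Y ** A) = Y ** A"
    using assms by (auto simp: is_pseudoinverse_def)
  have "A ** X = transpose (A ** Y ** (A ** X))"
    using X(3) Y(1) by (simp add: matrix_mul_assoc)
  also have "\<dots> = A ** X ** (A ** Y)"
    by (subst matrix_transpose_mul) (simp only: X(3) Y(3))
  also have "\<dots> = A ** Y"
    using X(1) by (simp add: matrix_mul_assoc)
  finally have AXY: "A ** X = A ** Y" .
  have "X ** A = transpose (X ** A ** (Y ** A))"
    using X(4) Y(1) by (metis matrix_mul_assoc)
  also have "\<dots> = Y ** A ** (X ** A)"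
    by (subst matrix_transpose_mul) (simp only: X(4) Y(4))
  also have "\<dots> = Y ** A"
    using X(1) by (metis matrix_mul_assoc)
  finally have XYA: "X ** A = Y ** A" .
  have "X = Y ** A ** X" using X(2) XYA by simp
  also have "\<dots> = Y ** A ** Y" using AXY by (metis matrix_mul_assoc)
  finally show ?thesis using Y(2) by simp
qed

lemma pseudoinverse_eqI: "is_pseudoinverse A X \<Longrightarrow> pseudoinverse A = X"
  unfolding pseudoinverse_def by (blast intro: pseudoinverse_unique)

lemma diag_matrix_mult: "diag_matrix v ** diag_matrix w = diag_matrix (\<chi> i. v $ i * w $ i)"
proof -
  have "(\<Sum>k\<in>UNIV. (if i = k then v $ i else 0) * (if k = j then w $ k else 0)) =
      (if i = j then v $ i * w $ i else 0)" for i j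
    by (subst sum.remove[of UNIV i]) (auto intro!: sum.neutral)
  then show ?thesis
    by (simp add: diag_matrix_def matrix_matrix_mult_def vec_eq_iff)
qed

lemma transpose_diag_matrix: "transpose (diag_matrix v) = diag_matrix v"
  by (auto simp: diag_matrix_def transpose_def vec_eq_iff)

lemma pseudoinverse_diag_matrix:
  "pseudoinverse (diag_matrix v) = diag_matrix (\<chi> i. inverse (v $ i))"
proof (rule pseudoinverse_eqI)
  have "(\<chi> i. v $ i * inverse (v $ i) * v $ i) = v"
    and "(\<chi> i. inverse (v $ i) * v $ i * inverse (v $ i)) = (\<chi> i. inverse (v $ i))"
    by (simp_all add: vec_eq_iff field_simps)
  then show "is_pseudoinverse (diag_matrix v) (diag_matrix (\<chi> i. inverse (v $ i)))"
    by (simp add: is_pseudoinverse_def diag_matrix_mult transpose_diag_matrix)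
qed

definition spectral_norm :: "real ^ 'n ^ 'm \<Rightarrow> real" where
  "spectral_norm A = onorm (\<lambda>v. A *v v)"

end

theory Submission
  imports Defs
begin

text \<open>
  In the coordinates \<open>y = x * exp u\<close> (entrywise) on the piece of \<open>x\<close>, the distance from \<open>x\<close> is the
  Euclidean norm of \<open>u\<close> as long as \<open>u\<close> vanishes where \<open>x\<close> does. Read in such coordinates around
  \<open>x\<close> and \<open>f x\<close>, the map \<open>f\<close> fixes the origin, and its derivative there is the matrix of the theorem;
  the condition number is the operator norm of this derivative. The pieces are the connected
  components, so if \<open>f\<close> maps no neighborhood of \<open>x\<close> into one component, there are points
  arbitrarily close to \<open>x\<close> with image at distance \<open>\<infinity>\<close> from \<open>f x\<close>.
\<close>

section \<open>Exponential coordinates on a piece\<close>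

text \<open>The parameter \<open>u\<close> ranges over the whole space, not only over the span of
  the piece. Neighborhoods of 0 are then ordinary open sets and derivatives at 0 need no
  restriction; the price is that entries of \<open>u\<close> at zeros of \<open>x\<close> are
  ignored.\<close>

definition scale_exp :: "real ^ 'n \<Rightarrow> real ^ 'n \<Rightarrow> real ^ 'n" where
  "scale_exp x u = (\<chi> i. x $ i * exp (u $ i))"

text \<open>Where \<open>x\<close> vanishes the entry is \<open>ln (y / 0) = ln 0 = 0\<close>.\<close>

definition log_ratio :: "real ^ 'n \<Rightarrow> real ^ 'n \<Rightarrow> real ^ 'n" where
  "log_ratio x y = (\<chi> i. ln (y $ i / x $ i))"

lemma sign_class_refl [simp]: "x \<in> sign_class x"
  by (simp add: sign_class_def)

lemma sign_class_eq: "y \<in> sign_class x \<Longrightarrow> sign_class y = sign_class x"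
  by (simp add: sign_class_def)

lemma scale_exp_0 [simp]: "scale_exp x 0 = x"
  by (simp add: scale_exp_def vec_eq_iff)

lemma scale_exp_in_sign_class [simp]: "scale_exp x u \<in> sign_class x"
  by (simp add: scale_exp_def sign_class_def sgn_mult)

lemma log_ratio_self [simp]: "log_ratio x x = 0"
proof -
  have "ln (x $ i / x $ i) = 0" for i
    by (cases "x $ i = 0") simp_all
  then show ?thesis by (simp add: log_ratio_def vec_eq_iff)
qed

lemma sign_class_quotient_pos:
  assumes "y \<in> sign_class x" "x $ i \<noteq> 0"
  shows "y $ i / x $ i > 0"
proof -
  have "sgn (y $ i) = sgn (x $ i)"
    using assms by (simp add: sign_class_def)
  then show ?thesis
    using assms(2) by (auto simp: sgn_if zero_less_divide_iff split: if_splits)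
qed

lemma scale_exp_log_ratio:
  assumes "y \<in> sign_class x"
  shows "scale_exp x (log_ratio x y) = y"
proof -
  have "x $ i * exp (ln (y $ i / x $ i)) = y $ i" for i
  proof (cases "x $ i = 0")
    case True
    then have "sgn (y $ i) = 0" using assms by (simp add: sign_class_def)
    with True show ?thesis by (simp add: sgn_zero_iff)
  next
    case False
    then show ?thesis using sign_class_quotient_pos[OF assms False] by simp
  qed
  then show ?thesis by (simp add: scale_exp_def log_ratio_def vec_eq_iff)
qed

text \<open>In this order the composite is only a projection, since entries of \<open>u\<close> at
  zeros of \<open>x\<close> leave no trace. Distances can be read off as \<open>norm u\<close> only
  for \<open>u\<close> fixed by it.\<close>

lemma log_ratio_scale_exp:
  "log_ratio x (scale_exp x u) = (\<chi> i. if x $ i = 0 then 0 else u $ i)"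
  by (simp add: log_ratio_def scale_exp_def vec_eq_iff)

lemma rel_dist_eq_norm_log_ratio:
  assumes "y \<in> sign_class x"
  shows "rel_dist x y = ennreal (norm (log_ratio x y))"
proof -
  have "(ln (x $ i / y $ i))\<^sup>2 = (ln (y $ i / x $ i))\<^sup>2" if "x $ i \<noteq> 0" for i
  proof -
    have "ln (inverse (y $ i / x $ i)) = - ln (y $ i / x $ i)"
      by (rule ln_inverse)
    then show ?thesis by simp
  qed
  then have "(\<Sum>i | x $ i \<noteq> 0. (ln (x $ i / y $ i))\<^sup>2) = (\<Sum>i | x $ i \<noteq> 0. (ln (y $ i / x $ i))\<^sup>2)"
    by simp
  \<comment> \<open>The added indices have \<open>x $ i = 0\<close>; division by zero gives 0 and
    \<open>ln 0 = 0\<close>, so their terms vanish.\<close>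
  also have "\<dots> = (\<Sum>i\<in>UNIV. (ln (y $ i / x $ i))\<^sup>2)"
    by (rule sum.mono_neutral_left) auto
  finally show ?thesis
    using assms by (simp add: rel_dist_def log_ratio_def norm_vec_def L2_set_def)
qed

lemma sign_class_if_rel_dist_less: "rel_dist x y < e \<Longrightarrow> y \<in> sign_class x"
  by (auto simp: rel_dist_def split: if_splits)

section \<open>Derivatives and continuity of the coordinate maps\<close>

lemma has_derivative_vec:
  fixes f :: "'a::real_normed_vector \<Rightarrow> real ^ 'n"
  assumes "\<And>i. ((\<lambda>x. f x $ i) has_derivative (\<lambda>h. f' h $ i)) (at a within A)"
  shows "(f has_derivative f') (at a within A)"
proof -
  have "((\<lambda>x. f x \<bullet> b) has_derivative (\<lambda>h. f' h \<bullet> b)) (at a within A)" if "b \<in> Basis" for b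
    using that assms by (auto simp: Basis_vec_def inner_axis)
  then show ?thesis by (subst has_derivative_componentwise_within) auto
qed

lemma has_derivative_scale_exp:
  "(scale_exp x has_derivative (\<lambda>v. diag_matrix x *v v)) (at 0)"
proof -
  have "diag_matrix x *v v = (\<chi> i. x $ i * v $ i)" for v
    by (simp add: diag_matrix_def matrix_vector_mult_def vec_eq_iff if_distrib [of "\<lambda>z. z * _"] cong: if_cong)
  then show ?thesis
    unfolding scale_exp_def
    by (auto intro!: has_derivative_vec derivative_eq_intros
        bounded_linear_imp_has_derivative[OF bounded_linear_vec_nth])
qed

text \<open>At a zero of \<open>x\<close> the coordinate function is constantly 0, in agreement with
  \<open>inverse 0 = 0\<close>. This is where the pseudoinverse of the diagonal matrix comes
  from.\<close>

lemma has_derivative_log_ratio: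
  "(log_ratio x has_derivative (\<lambda>v. diag_matrix (\<chi> i. inverse (x $ i)) *v v)) (at x)"
proof -
  have "diag_matrix (\<chi> i. inverse (x $ i)) *v v = (\<chi> i. inverse (x $ i) * v $ i)" for v
    by (simp add: diag_matrix_def matrix_vector_mult_def vec_eq_iff if_distrib [of "\<lambda>z. z * _"] cong: if_cong)
  moreover have "((\<lambda>y. ln (y $ i / x $ i)) has_derivative (\<lambda>v. inverse (x $ i) * v $ i)) (at x)" for i
  proof (cases "x $ i = 0")
    case False
    then show ?thesis
      by (auto intro!: derivative_eq_intros bounded_linear_imp_has_derivative[OF bounded_linear_vec_nth]
          simp: field_simps)
  qed simp
  ultimately show ?thesis
    unfolding log_ratio_def by (auto intro!: has_derivative_vec)
qed

lemma isCont_scale_exp: "isCont (scale_exp x) u"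
proof -
  have "continuous_on UNIV (scale_exp x)"
    unfolding scale_exp_def by (intro continuous_intros)
  then show ?thesis by (simp add: continuous_on_eq_continuous_at)
qed

lemma scale_exp_near:
  assumes "d > 0"
  obtains e where "e > 0" "\<And>v. dist v u < e \<Longrightarrow> dist (scale_exp x v) (scale_exp x u) < d"
proof -
  have "\<exists>e>0. \<forall>v. dist v u < e \<longrightarrow> dist (scale_exp x v) (scale_exp x u) < d"
    using isCont_scale_exp[where x = x and u = u] assms unfolding continuous_at_eps_delta by simp
  then show thesis using that by (elim exE conjE) simp
qed

lemma log_ratio_small_near:
  assumes "r > 0"
  obtains d where "d > 0" "\<And>y. dist y x < d \<Longrightarrow> norm (log_ratio x y) < r"
proof -
  have "isCont (log_ratio x) x"
    by (rule has_derivative_continuous[OF has_derivative_log_ratio])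
  then have "\<exists>d>0. \<forall>y. dist y x < d \<longrightarrow> dist (log_ratio x y) (log_ratio x x) < r"
    using assms unfolding continuous_at_eps_delta by simp
  then show thesis using that by (elim exE conjE) (simp add: dist_norm)
qed

section \<open>The topology and its connected components\<close>

lemma ennreal_pos_dense_real:
  assumes "(0::ennreal) < e"
  obtains r :: real where "0 < ennreal r" "ennreal r < e"
proof -
  obtain c where c: "0 < c" "c < e" using dense[OF assms] by blast
  then have "c < top" using order_less_le_trans top_greatest by blast
  then have "ennreal (enn2real c) = c" by simp
  with c show thesis using that by metis
qed

text \<open>Within a piece, small balls of the two distances around \<open>x\<close> contain one
  another: \<open>log_ratio x\<close> is continuous at \<open>x\<close>, and
  \<open>scale_exp x\<close> is continuous at 0. A radius from the definition may be infinite, so it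
  is first replaced by a smaller real one.\<close>

lemma openin_rel_topology_iff:
  "openin rel_topology U \<longleftrightarrow> (\<forall>x\<in>U. \<exists>d>0. \<forall>y\<in>sign_class x. dist y x < d \<longrightarrow> y \<in> U)"
  unfolding openin_rel_topology
proof (intro ball_cong refl iffI)
  fix x assume "\<exists>e>0. {y. rel_dist x y < e} \<subseteq> U"
  then obtain e where e: "e > 0" "{y. rel_dist x y < e} \<subseteq> U" by blast
  obtain r where r: "0 < ennreal r" "ennreal r < e"
    using ennreal_pos_dense_real[OF e(1)] by blast
  then have "r > 0" by (simp add: ennreal_less_zero_iff)
  obtain d where d: "d > 0" "\<And>y. dist y x < d \<Longrightarrow> norm (log_ratio x y) < r"
    using log_ratio_small_near[OF \<open>r > 0\<close>] by blast
  have "y \<in> U" if "y \<in> sign_class x" "dist y x < d" for y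
  proof -
    have "rel_dist x y < ennreal r"
      using d(2)[OF that(2)] that(1) by (simp add: rel_dist_eq_norm_log_ratio ennreal_less_iff)
    then have "rel_dist x y < e" using r(2) by (rule less_trans)
    then show ?thesis using e(2) by blast
  qed
  with d(1) show "\<exists>d>0. \<forall>y\<in>sign_class x. dist y x < d \<longrightarrow> y \<in> U" by blast
next
  fix x assume "\<exists>d>0. \<forall>y\<in>sign_class x. dist y x < d \<longrightarrow> y \<in> U"
  then obtain d where d: "d > 0" "\<And>y. y \<in> sign_class x \<Longrightarrow> dist y x < d \<Longrightarrow> y \<in> U" by blast
  obtain e where "e > 0" "\<And>u. dist u 0 < e \<Longrightarrow> dist (scale_exp x u) (scale_exp x 0) < d"
    using scale_exp_near[OF d(1), where x = x and u = 0] by blast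
  then have e: "e > 0" "\<And>u. norm u < e \<Longrightarrow> dist (scale_exp x u) x < d"
    by (simp_all add: dist_norm)
  have "y \<in> U" if "rel_dist x y < ennreal e" for y
  proof -
    have y: "y \<in> sign_class x"
      using that by (rule sign_class_if_rel_dist_less)
    then have "norm (log_ratio x y) < e"
      using that by (simp add: rel_dist_eq_norm_log_ratio ennreal_less_iff)
    from e(2)[OF this] show ?thesis using d(2) y by (simp add: scale_exp_log_ratio)
  qed
  with e(1) show "\<exists>e>0. {y. rel_dist x y < e} \<subseteq> U"
    by (intro exI[of _ "ennreal e"]) (auto simp: ennreal_less_zero_iff)
qed

lemma topspace_rel_topology [simp]: "topspace rel_topology = UNIV"
proof -
  have "openin rel_topology UNIV" by (auto simp: openin_rel_topology_iff intro: exI[of _ 1])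
  then show ?thesis using openin_subset by blast
qed

lemma openin_rel_topology_sign_class: "openin rel_topology (sign_class x)"
  unfolding openin_rel_topology_iff by (metis sign_class_eq zero_less_one)

lemma closedin_rel_topology_sign_class: "closedin rel_topology (sign_class x)"
proof -
  have "y \<in> sign_class z" if "z \<in> sign_class y" for y z :: "real ^ 'n"
    using that by (simp add: sign_class_def)
  then have "\<forall>y\<in>- sign_class x. sign_class y \<subseteq> - sign_class x"
    using sign_class_eq by blast
  then have "openin rel_topology (- sign_class x)"
    unfolding openin_rel_topology_iff by (meson subsetD zero_less_one)
  then show ?thesis by (simp add: closedin_def Compl_eq_Diff_UNIV)
qed

text \<open>This is continuity of \<open>scale_exp x\<close> into the finer topology. Its values
  never leave one piece, so the restriction to a piece in the openness criterion is automatic and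
  Euclidean continuity suffices.\<close>

lemma open_vimage_scale_exp:
  assumes "openin rel_topology U"
  shows "open (scale_exp x -` U)"
  unfolding open_dist
proof
  fix u assume u: "u \<in> scale_exp x -` U"
  obtain d where d: "d > 0"
      "\<And>y. y \<in> sign_class (scale_exp x u) \<Longrightarrow> dist y (scale_exp x u) < d \<Longrightarrow> y \<in> U"
    using assms u unfolding openin_rel_topology_iff by blast
  obtain e where e: "e > 0"
      "\<And>v. dist v u < e \<Longrightarrow> dist (scale_exp x v) (scale_exp x u) < d"
    using scale_exp_near[OF d(1), where x = x and u = u] by blast
  have "scale_exp x v \<in> U" if "dist v u < e" for v
    using d(2)[OF _ e(2)[OF that]] sign_class_eq[OF scale_exp_in_sign_class[of x u]] by simp
  with e(1) show "\<exists>e>0. \<forall>v. dist v u < e \<longrightarrow> v \<in> scale_exp x -` U" by auto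
qed

text \<open>The piece is the continuous image of the whole Euclidean space, which is
  connected.\<close>

lemma connectedin_rel_topology_sign_class: "connectedin rel_topology (sign_class x)"
proof -
  have "continuous_map euclidean rel_topology (scale_exp x)"
    using open_vimage_scale_exp by (auto simp: continuous_map_def vimage_def)
  then have "connectedin rel_topology (range (scale_exp x))"
    by (rule connectedin_continuous_map_image) (simp add: connected_UNIV)
  moreover have "range (scale_exp x) = sign_class x"
  proof
    show "sign_class x \<subseteq> range (scale_exp x)"
    proof
      fix y assume "y \<in> sign_class x"
      then have "y = scale_exp x (log_ratio x y)" by (simp add: scale_exp_log_ratio)
      then show "y \<in> range (scale_exp x)" by (rule range_eqI)
    qed
  qed auto
  ultimately show ?thesis by simp
qed

text \<open>A connected set containing \<open>x\<close> cannot leave the clopen piece of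
  \<open>x\<close>, and the piece is itself connected.\<close>

lemma connected_components_of_rel_topology:
  "C \<in> connected_components_of rel_topology \<longleftrightarrow> (\<exists>x. C = sign_class x)"
proof -
  have "connected_component_of_set rel_topology x = sign_class x" for x :: "real ^ 'n"
  proof
    have "connectedin rel_topology (connected_component_of_set rel_topology x)"
      by (rule connectedin_connected_component_of)
    moreover have "x \<in> connected_component_of_set rel_topology x"
      by (simp add: connected_component_of_refl)
    ultimately show "connected_component_of_set rel_topology x \<subseteq> sign_class x"
      using connectedin_clopen_cases[OF _ closedin_rel_topology_sign_class openin_rel_topology_sign_class,
          of "connected_component_of_set rel_topology x" x] sign_class_refl[of x]
      unfolding disjnt_iff by blast
    show "sign_class x \<subseteq> connected_component_of_set rel_topology x"
      by (rule connected_component_of_maximal[OF connectedin_rel_topology_sign_class]) simp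
  qed
  then show ?thesis by (auto simp: connected_components_of_def)
qed

section \<open>The condition number as an operator norm\<close>

lemma cond_number_geI:
  assumes "\<And>\<epsilon>. \<epsilon> > 0 \<Longrightarrow> L \<le> cond_sup S f x \<epsilon>"
  shows "L \<le> cond_number S f x"
proof (rule tendsto_lowerbound[OF cond_sup_tendsto])
  show "\<forall>\<^sub>F \<epsilon> in at_right 0. L \<le> cond_sup S f x \<epsilon>"
    using assms by (simp add: eventually_at_filter)
qed simp

lemma cond_number_leI:
  assumes "r > 0"
    and "\<And>y. y \<in> S \<Longrightarrow> 0 < rel_dist x y \<Longrightarrow> rel_dist x y < ennreal r \<Longrightarrow>
           rel_dist (f x) (f y) / rel_dist x y \<le> L"
  shows "cond_number S f x \<le> L"
proof (rule tendsto_upperbound[OF cond_sup_tendsto])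
  have "cond_sup S f x \<epsilon> \<le> L" if "0 < \<epsilon>" "\<epsilon> < r" for \<epsilon>
    unfolding cond_sup_def
  proof (rule SUP_least)
    have "ennreal \<epsilon> < ennreal r" using that by (simp add: ennreal_less_iff)
    then show "rel_dist (f x) (f y) / rel_dist x y \<le> L"
      if "y \<in> {y \<in> S. 0 < rel_dist x y \<and> rel_dist x y \<le> ennreal \<epsilon>}" for y
      using assms(2) that by (auto intro: le_less_trans)
  qed
  then show "\<forall>\<^sub>F \<epsilon> in at_right 0. cond_sup S f x \<epsilon> \<le> L"
    unfolding eventually_at_right_field using assms(1) by blast
qed simp

text \<open>With \<open>h\<close> denoting \<open>f\<close> in exponential coordinates, the quotient
  of distances is \<open>norm (h u) / norm u\<close>. The first-order expansion of \<open>h\<close>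
  at 0 bounds it above for all small \<open>u\<close>; following rays towards 0 gives the lower
  bound.\<close>

lemma cond_number_eq_spectral_norm:
  fixes f :: "real ^ 'm \<Rightarrow> real ^ 'n"
  assumes N: "openin rel_topology N" "x \<in> N" "N \<subseteq> S" "f ` N \<subseteq> sign_class (f x)"
    and D: "(f has_derivative D) (at x within (S \<inter> sign_class x))"
  shows "cond_number S f x =
    ennreal (spectral_norm (pseudoinverse (diag_matrix (f x)) ** matrix D ** diag_matrix x))"
proof -
  define M where "M = pseudoinverse (diag_matrix (f x)) ** matrix D ** diag_matrix x"
  define h where "h u = log_ratio (f x) (f (scale_exp x u))" for u
  define V where "V = scale_exp x -` N"
  have V: "open V" "0 \<in> V"
    using N by (simp_all add: V_def open_vimage_scale_exp)
  have h0: "h 0 = 0" by (simp add: h_def)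
  have linM: "bounded_linear ((*v) M)"
    by (rule matrix_vector_mul_bounded_linear)
  have "scale_exp x ` V \<subseteq> S \<inter> sign_class x"
    using N(3) by (auto simp: V_def)
  \<comment> \<open>The derivative of \<open>f\<close> is given only within the piece. Since
    \<open>scale_exp x\<close> maps \<open>V\<close> into that piece, the chain rule applies within
    \<open>V\<close>, and openness of \<open>V\<close> then removes the restriction.\<close>
  then have "(f has_derivative D) (at (scale_exp x 0) within scale_exp x ` V)"
    using has_derivative_subset[OF D] by simp
  then have "((\<lambda>u. f (scale_exp x u)) has_derivative (\<lambda>v. D (diag_matrix x *v v))) (at 0 within V)"
    by (rule has_derivative_in_compose[OF has_derivative_at_withinI[OF has_derivative_scale_exp]])
  then have "((\<lambda>u. f (scale_exp x u)) has_derivative (\<lambda>v. D (diag_matrix x *v v))) (at 0)"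
    by (simp only: at_within_open[OF V(2) V(1)])
  then have "(h has_derivative (\<lambda>v. diag_matrix (\<chi> i. inverse (f x $ i)) *v D (diag_matrix x *v v))) (at 0)"
    unfolding h_def by (rule has_derivative_compose) (simp add: has_derivative_log_ratio)
  moreover have "diag_matrix (\<chi> i. inverse (f x $ i)) *v D (diag_matrix x *v v) = M *v v" for v
    using has_derivative_linear[OF D]
    by (simp add: M_def pseudoinverse_diag_matrix matrix_works flip: matrix_vector_mul_assoc)
  ultimately have h: "(h has_derivative (*v) M) (at 0)" by simp
  have approx: "\<exists>r>0. \<forall>u. norm u < r \<longrightarrow> scale_exp x u \<in> N \<and> norm (h u - M *v u) \<le> \<delta> * norm u"
    if \<delta>: "\<delta> > 0" for \<delta>
  proof -
    have "\<forall>\<delta>>0. \<exists>r>0. \<forall>u. norm u < r \<longrightarrow> norm (h u - M *v u) \<le> \<delta> * norm u"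
      using h unfolding has_derivative_at_alt by (simp add: h0)
    then obtain r1 where r1: "r1 > 0" "\<And>u. norm u < r1 \<Longrightarrow> norm (h u - M *v u) \<le> \<delta> * norm u"
      using \<delta> by blast
    obtain r2 where r2: "r2 > 0" "ball 0 r2 \<subseteq> V"
      using V open_contains_ball by blast
    show ?thesis
      using r1 r2 by (intro exI[of _ "min r1 r2"]) (auto simp: V_def subset_iff)
  qed
  have dist_image: "rel_dist (f x) (f (scale_exp x u)) = ennreal (norm (h u))" if "scale_exp x u \<in> N" for u
    using N(4) that by (auto simp: h_def intro: rel_dist_eq_norm_log_ratio)
  have upper: "cond_number S f x \<le> ennreal (onorm ((*v) M))"
  proof (rule ennreal_le_epsilon)
    fix \<delta> :: real assume \<delta>: "\<delta> > 0"
    obtain r where r: "r > 0"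
        "\<And>u. norm u < r \<Longrightarrow> scale_exp x u \<in> N \<and> norm (h u - M *v u) \<le> \<delta> * norm u"
      using approx[OF \<delta>] by blast
    have "cond_number S f x \<le> ennreal (onorm ((*v) M) + \<delta>)"
      using r(1)
    proof (rule cond_number_leI)
      fix y assume y: "0 < rel_dist x y" "rel_dist x y < ennreal r"
      define u where "u = log_ratio x y"
      have ys: "y \<in> sign_class x"
        using y(2) by (rule sign_class_if_rel_dist_less)
      then have d: "rel_dist x y = ennreal (norm u)" and yu: "y = scale_exp x u"
        by (simp_all add: u_def rel_dist_eq_norm_log_ratio scale_exp_log_ratio)
      have u: "norm u < r" "norm u > 0"
        using y by (simp_all add: d ennreal_less_iff ennreal_less_zero_iff)
      have "norm (h u) \<le> norm (M *v u) + norm (h u - M *v u)"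
        by (metis norm_triangle_sub)
      also have "\<dots> \<le> onorm ((*v) M) * norm u + \<delta> * norm u"
        using r(2)[OF u(1)] onorm[OF linM] by (intro add_mono) auto
      finally have "norm (h u) / norm u \<le> onorm ((*v) M) + \<delta>"
        using u(2) by (simp add: field_simps)
      then show "rel_dist (f x) (f y) / rel_dist x y \<le> ennreal (onorm ((*v) M) + \<delta>)"
        using u r(2)[OF u(1)] by (simp add: d yu[symmetric] dist_image[of u, folded yu] divide_ennreal ennreal_leI)
    qed
    then show "cond_number S f x \<le> ennreal (onorm ((*v) M)) + ennreal \<delta>"
      using \<delta> onorm_pos_le[OF linM] by simp
  qed
  \<comment> \<open>Finiteness from the upper bound gives a real value \<open>l\<close>, so that the
    lower bound can be argued in the reals.\<close>
  then have "cond_number S f x < \<infinity>"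
    by (metis ennreal_less_top infinity_ennreal_def le_less_trans)
  then obtain l where l: "l \<ge> 0" "cond_number S f x = ennreal l"
    by (cases "cond_number S f x") auto
  have bound: "norm (M *v v) \<le> (l + \<delta>) * norm v" if \<delta>: "\<delta> > 0" for \<delta> v
  proof -
    \<comment> \<open>Dropping the entries at zeros of \<open>x\<close> does not change the image
      under \<open>M\<close>, because \<open>diag_matrix x\<close> kills them, and does not increase
      the norm. For multiples of \<open>w\<close> the distance from \<open>x\<close> is exactly the
      norm.\<close>
    define w where "w = (\<chi> i. if x $ i = 0 then 0 else v $ i)"
    have "diag_matrix x *v v = diag_matrix x *v w"
      unfolding w_def diag_matrix_def matrix_vector_mult_def
      by (auto simp: vec_eq_iff intro!: sum.cong)
    then have Mw: "M *v v = M *v w"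
      by (simp add: M_def flip: matrix_vector_mul_assoc)
    have wv: "norm w \<le> norm v"
      by (rule norm_le_componentwise_cart) (simp add: w_def)
    have "norm (M *v w) \<le> (l + \<delta>) * norm w"
    proof (cases "w = 0")
      case False
      \<comment> \<open>If the difference is negative, \<open>ennreal\<close> truncates it to 0; as
        \<open>l \<ge> 0\<close>, the inequality still reads back correctly in the reals.\<close>
      have "ennreal (norm (M *v w) / norm w - \<delta>) \<le> cond_number S f x"
      proof (rule cond_number_geI)
        fix \<epsilon> :: real assume \<epsilon>: "\<epsilon> > 0"
        obtain r where r: "r > 0"
            "\<And>u. norm u < r \<Longrightarrow> scale_exp x u \<in> N \<and> norm (h u - M *v u) \<le> \<delta> * norm u"
          using approx[OF \<delta>] by blast
        \<comment> \<open>The scaling makes \<open>norm u\<close> equal to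
          \<open>min \<epsilon> (r / 2)\<close>: at most \<open>\<epsilon>\<close>, as the supremum
          requires, and strictly below \<open>r\<close>, as the expansion requires.\<close>
        define t where "t = min \<epsilon> (r / 2) / norm w"
        define u where "u = t *\<^sub>R w"
        have t: "t > 0" using \<epsilon> r(1) False by (simp add: t_def)
        have nu: "norm u = min \<epsilon> (r / 2)"
          using \<epsilon> r(1) False by (simp add: u_def t_def)
        have u: "norm u > 0" "norm u < r" "norm u \<le> \<epsilon>"
          using \<epsilon> r(1) by (auto simp: nu)
        have "log_ratio x (scale_exp x u) = u"
          by (simp add: log_ratio_scale_exp u_def w_def vec_eq_iff)
        then have d: "rel_dist x (scale_exp x u) = ennreal (norm u)"
          by (simp add: rel_dist_eq_norm_log_ratio)
        have ru: "scale_exp x u \<in> N" "norm (h u - M *v u) \<le> \<delta> * norm u"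
          using r(2)[OF u(2)] by auto
        have "norm (M *v u) \<le> norm (h u) + \<delta> * norm u"
          using ru(2) norm_triangle_sub[of "M *v u" "h u"] by (simp add: norm_minus_commute)
        then have "norm (M *v u) / norm u \<le> (norm (h u) + \<delta> * norm u) / norm u"
          by (rule divide_right_mono) simp
        then have "norm (M *v u) / norm u - \<delta> \<le> norm (h u) / norm u"
          using u(1) by (simp add: add_divide_distrib)
        \<comment> \<open>By linearity the quotient is constant along the ray, so arbitrarily small
          \<open>u\<close> still see the full stretching factor of \<open>w\<close>.\<close>
        moreover have "norm (M *v u) / norm u = norm (M *v w) / norm w"
          using t by (simp add: u_def matrix_vector_mult_scaleR)
        ultimately have "ennreal (norm (M *v w) / norm w - \<delta>) \<le>
            rel_dist (f x) (f (scale_exp x u)) / rel_dist x (scale_exp x u)"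
          using u(1) ru(1) by (simp add: d dist_image divide_ennreal ennreal_leI)
        also have "\<dots> \<le> cond_sup S f x \<epsilon>"
          unfolding cond_sup_def
          by (rule SUP_upper) (use u ru(1) N(3) d in \<open>auto simp: ennreal_leI ennreal_less_zero_iff\<close>)
        finally show "ennreal (norm (M *v w) / norm w - \<delta>) \<le> cond_sup S f x \<epsilon>" .
      qed
      then have "norm (M *v w) / norm w - \<delta> \<le> l"
        using l by simp
      then show ?thesis using False by (simp add: diff_le_eq pos_divide_le_eq)
    qed simp
    also have "\<dots> \<le> (l + \<delta>) * norm v"
      using wv l(1) \<delta> by (intro mult_left_mono) auto
    finally show ?thesis by (simp add: Mw)
  qed
  have "onorm ((*v) M) \<le> l"
  proof (rule field_le_epsilon)
    fix \<delta> :: real assume "\<delta> > 0"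
    then show "onorm ((*v) M) \<le> l + \<delta>" by (intro onorm_le bound)
  qed
  then have "ennreal (onorm ((*v) M)) \<le> cond_number S f x"
    by (simp add: l ennreal_leI)
  with upper show ?thesis by (simp add: spectral_norm_def M_def)
qed

section \<open>Locally constant maps and infinite condition numbers\<close>

lemma cond_number_locally_constant:
  assumes N: "openin rel_topology N" "x \<in> N" and c: "\<And>y. y \<in> N \<Longrightarrow> f y = c"
  shows "cond_number S f x = 0"
proof -
  obtain e where e: "e > 0" "{y. rel_dist x y < e} \<subseteq> N"
    using N unfolding openin_rel_topology by blast
  obtain r where r: "0 < ennreal r" "ennreal r < e"
    using ennreal_pos_dense_real[OF e(1)] by blast
  have "cond_number S f x \<le> 0"
  proof (rule cond_number_leI)
    show "r > 0" using r(1) by (simp add: ennreal_less_zero_iff)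
    fix y assume "rel_dist x y < ennreal r"
    then have "rel_dist x y < e" using r(2) by (rule less_trans)
    then have "y \<in> N" using e(2) by blast
    then have "rel_dist (f x) (f y) = 0"
      using c N(2) by (simp add: rel_dist_eq_norm_log_ratio)
    then show "rel_dist (f x) (f y) / rel_dist x y \<le> 0" by simp
  qed
  then show ?thesis by simp
qed

text \<open>Small Euclidean balls intersected with \<open>S\<close> and the piece of
  \<open>x\<close> are admissible neighborhoods, so each contains a point whose image lies in
  another piece. One such point at every scale makes every supremum infinite.\<close>

lemma cond_number_eq_infinity:
  assumes S: "openin rel_topology S" "x \<in> S"
    and not: "\<And>N. openin rel_topology N \<Longrightarrow> x \<in> N \<Longrightarrow> N \<subseteq> S \<Longrightarrow> \<not> f ` N \<subseteq> sign_class (f x)"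
  shows "cond_number S f x = \<infinity>"
proof -
  have "\<infinity> \<le> cond_number S f x"
  proof (rule cond_number_geI)
    fix \<epsilon> :: real assume \<epsilon>: "\<epsilon> > 0"
    obtain d where d: "d > 0" "\<And>y. dist y x < d \<Longrightarrow> norm (log_ratio x y) < \<epsilon>"
      using log_ratio_small_near[OF \<epsilon>] by blast
    have "openin rel_topology (ball x d)"
      unfolding openin_rel_topology_iff using open_ball[of x d] unfolding open_dist by blast
    then have "openin rel_topology (S \<inter> sign_class x \<inter> ball x d)"
      using S(1) openin_rel_topology_sign_class by (intro openin_Int) auto
    then have "\<not> f ` (S \<inter> sign_class x \<inter> ball x d) \<subseteq> sign_class (f x)"
      by (rule not) (use S(2) d(1) in auto)
    then obtain y where y: "y \<in> S" "y \<in> sign_class x" "y \<in> ball x d" "f y \<notin> sign_class (f x)"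
      by blast
    have fin: "rel_dist x y = ennreal (norm (log_ratio x y))"
      using y(2) by (rule rel_dist_eq_norm_log_ratio)
    \<comment> \<open>Otherwise \<open>y = x\<close>, but \<open>f y\<close> and \<open>f x\<close>
      lie in different pieces.\<close>
    have "log_ratio x y \<noteq> 0"
      using scale_exp_log_ratio[OF y(2)] y(4) by force
    then have y_mem: "y \<in> {y \<in> S. 0 < rel_dist x y \<and> rel_dist x y \<le> ennreal \<epsilon>}"
      using y(1) d(2)[of y] y(3) by (simp add: dist_commute fin ennreal_leI ennreal_less_zero_iff)
    \<comment> \<open>The denominator must be finite, since \<open>\<infinity> / \<infinity>\<close>
      is 0 in \<open>ennreal\<close>; this is why \<open>y\<close> was taken in the piece of
      \<open>x\<close>.\<close>
    have "rel_dist (f x) (f y) / rel_dist x y = \<infinity>"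
      using y(4) by (simp add: rel_dist_def[of "f x"] fin ennreal_top_divide)
    then show "\<infinity> \<le> cond_sup S f x \<epsilon>"
      using SUP_upper[OF y_mem, of "\<lambda>y. rel_dist (f x) (f y) / rel_dist x y"]
      by (simp add: cond_sup_def)
  qed
  then show ?thesis by (simp add: top_unique)
qed

theorem proposition3p5:
  fixes S :: "(real ^ 'm) set"
    and f :: "real ^ 'm \<Rightarrow> real ^ 'n"
    and D :: "real ^ 'm \<Rightarrow> real ^ 'm \<Rightarrow> real ^ 'n"
  assumes "openin rel_topology S"
    and "\<And>x. x \<in> S \<Longrightarrow> (f has_derivative D x) (at x within (S \<inter> sign_class x))"
  shows "\<forall>x\<in>S.
      ((\<exists>N C. openin rel_topology N \<and> x \<in> N \<and> N \<subseteq> S \<and>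
              C \<in> connected_components_of rel_topology \<and> f ` N \<subseteq> C) \<longrightarrow>
         cond_number S f x =
           ennreal (spectral_norm
             (pseudoinverse (diag_matrix (f x)) ** matrix (D x) ** diag_matrix x))) \<and>
      ((\<exists>N c. openin rel_topology N \<and> x \<in> N \<and> N \<subseteq> S \<and> (\<forall>y\<in>N. f y = c)) \<longrightarrow>
         cond_number S f x = 0) \<and>
      (\<not> (\<exists>N C. openin rel_topology N \<and> x \<in> N \<and> N \<subseteq> S \<and>
              C \<in> connected_components_of rel_topology \<and> f ` N \<subseteq> C) \<longrightarrow>
         cond_number S f x = \<infinity>)"
proof (intro ballI conjI impI)
  fix x assume x: "x \<in> S"
  assume "\<exists>N C. openin rel_topology N \<and> x \<in> N \<and> N \<subseteq> S \<and>
      C \<in> connected_components_of rel_topology \<and> f ` N \<subseteq> C"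
  then obtain N C where N: "openin rel_topology N" "x \<in> N" "N \<subseteq> S"
    and C: "C \<in> connected_components_of rel_topology" "f ` N \<subseteq> C" by blast
  \<comment> \<open>The component is some piece, and it contains \<open>f x\<close> because
    \<open>x \<in> N\<close>.\<close>
  have "C = sign_class (f x)"
    using C N(2) sign_class_eq by (metis connected_components_of_rel_topology image_subset_iff)
  with C N x assms(2) show "cond_number S f x =
      ennreal (spectral_norm
        (pseudoinverse (diag_matrix (f x)) ** matrix (D x) ** diag_matrix x))"
    by (intro cond_number_eq_spectral_norm) auto
next
  fix x assume "\<exists>N c. openin rel_topology N \<and> x \<in> N \<and> N \<subseteq> S \<and> (\<forall>y\<in>N. f y = c)"
  then show "cond_number S f x = 0"
    using cond_number_locally_constant by blast
next
  fix x assume x: "x \<in> S"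
  assume "\<not> (\<exists>N C. openin rel_topology N \<and> x \<in> N \<and> N \<subseteq> S \<and>
      C \<in> connected_components_of rel_topology \<and> f ` N \<subseteq> C)"
  then have "\<not> f ` N \<subseteq> sign_class (f x)" if "openin rel_topology N" "x \<in> N" "N \<subseteq> S" for N
    using that connected_components_of_rel_topology[of "sign_class (f x)"] by blast
  with assms(1) x show "cond_number S f x = \<infinity>"
    by (rule cond_number_eq_infinity)
qed

end
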